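(* Let $\mathbf{A}\in\mathbb{C}^{n\times n}$ with $\operatorname{Ind}\mathbf{A}=k_1$ and $\operatorname{rank}\mathbf{A}^{k_1+1}=\operatorname{rank}\mathbf{A}^{k_1}=r_1$, $1\le r_1\le n$; let $\mathbf{B}\in\mathbb{C}^{m\times m}$ with $\operatorname{Ind}\mathbf{B}=k_2$ and $\operatorname{rank}\mathbf{B}^{k_2+1}=\operatorname{rank}\mathbf{B}^{k_2}=r_2$, $1\le r_2\le m$; and let $\mathbf{D}\in\mathbb{C}^{n\times m}$. Put $\widetilde{\mathbf{D}}=\mathbf{A}^{k_1}\mathbf{D}\mathbf{B}^{k_2}\in\mathbb{C}^{n\times m}$, with $i$th row $\widetilde{\mathbf{d}}_{i.}$ and $j$th column $\widetilde{\mathbf{d}}_{.j}$. Define, for $i=1,\dots,n$ and $j=1,\dots,m$, the column vector $\mathbf{d}^{\mathbf{B}}_{.j}\in\mathbb{C}^{n}$ and the row vector $\mathbf{d}^{\mathbf{A}}_{i.}\in\mathbb{C}^{1\times m}$ by $$\mathbf{d}^{\mathbf{B}}_{.j}=\left[\sum_{\alpha\in I_{r_2,m}\{j\}}\left|\left(\mathbf{B}^{k_2+1}_{j.}(\widetilde{\mathbf{d}}_{1.})\right)^{\alpha}_{\alpha}\right|,\dots,\sum_{\alpha\in I_{r_2,m}\{j\}}\left|\left(\mathbf{B}^{k_2+1}_{j.}(\widetilde{\mathbf{d}}_{n.})\right)^{\alpha}_{\alpha}\right|\right]^{T},$$ $$\mathbf{d}^{\mathbf{A}}_{i.}=\left[\sum_{\beta\in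 J_{r_1,n}\{i\}}\left|\left(\mathbf{A}^{k_1+1}_{.i}(\widetilde{\mathbf{d}}_{.1})\right)^{\beta}_{\beta}\right|,\dots,\sum_{\beta\in J_{r_1,n}\{i\}}\left|\left(\mathbf{A}^{k_1+1}_{.i}(\widetilde{\mathbf{d}}_{.m})\right)^{\beta}_{\beta}\right|\right].$$ Then the Drazin inverse solution $\mathbf{X}=\mathbf{A}^{D}\mathbf{D}\mathbf{B}^{D}=(x_{ij})\in\mathbb{C}^{n\times m}$ of the matrix equation $\mathbf{A}\mathbf{X}\mathbf{B}=\mathbf{D}$ satisfies, for all $i=1,\dots,n$, $j=1,\dots,m$, both $$x_{ij}=\frac{\sum_{\beta\in J_{r_1,n}\{i\}}\left|\left(\mathbf{A}^{k_1+1}_{.i}\left(\mathbf{d}^{\mathbf{B}}_{.j}\right)\right)^{\beta}_{\beta}\right|}{\sum_{\beta\in J_{r_1,n}}\left|\left(\mathbf{A}^{k_1+1}\right)^{\beta}_{\beta}\right|\ \sum_{\alpha\in I_{r_2,m}}\left|\left(\mathbf{B}^{k_2+1}\right)^{\alpha}_{\alpha}\right|}$$ and $$x_{ij}=\frac{\sum_{\alpha\in I_{r_2,m}\{j\}}\left|\left(\mathbf{B}^{k_2+1}_{j.}\left(\mathbf{d}^{\mathbf{A}}_{i.}\right)\right)^{\alpha}_{\alpha}\right|}{\sum_{\beta\in J_{r_1,n}}\left|\left(\mathbf{A}^{k_1+1}\right)^{\beta}_{\beta}\right|\ \sum_{\alpha\in I_{r_2,m}}\left|\left(\mathbf{B}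^{k_2+1}\right)^{\alpha}_{\alpha}\right|}.$$
   Context: For a square complex matrix $\mathbf{A}$, the index $\operatorname{Ind}\mathbf{A}$ is the smallest nonnegative integer $k$ with $\operatorname{rank}\mathbf{A}^{k+1}=\operatorname{rank}\mathbf{A}^{k}$. The Drazin inverse $\mathbf{A}^{D}$ of a matrix with $\operatorname{Ind}\mathbf A=k$ is the unique matrix $\mathbf{X}$ satisfying $\mathbf{A}^{k+1}\mathbf{X}=\mathbf{A}^{k}$, $\mathbf{X}\mathbf{A}\mathbf{X}=\mathbf{X}$, $\mathbf{A}\mathbf{X}=\mathbf{X}\mathbf{A}$. The "Drazin inverse solution" of $\mathbf{A}\mathbf{X}\mathbf{B}=\mathbf{D}$ means, by definition, the matrix $\mathbf{A}^{D}\mathbf{D}\mathbf{B}^{D}$. Notation: for a matrix $\mathbf{M}$, $\mathbf{M}_{.i}(\mathbf{b})$ is the matrix obtained from $\mathbf{M}$ by replacing its $i$th column with the column vector $\mathbf{b}$, and $\mathbf{M}_{j.}(\mathbf{b})$ is the matrix obtained by replacing its $j$th row with the row vector $\mathbf{b}$; $\mathbf{A}^{p}_{.i}(\mathbf{b})$ means $(\mathbf{A}^{p})_{.i}(\mathbf{b})$ and $\mathbf{B}^{p}_{j.}(\mathbf{b})$ means $(\mathbf{B}^{p})_{j.}(\mathbf{b})$. $|\mathbf{M}^{\alpha}_{\alpha}|$ is the principal minor of $\mathbf{M}$ with rows and columns indexed by $\alpha$. For $1\le r\le n$, both $I_{r,n}$ and $J_{r,n}$ denote the set of all strictly increasing sequences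 of $r$ integers from $\{1,\dots,n\}$ (equivalently, $r$-element subsets), and $I_{r,n}\{i\}=J_{r,n}\{i\}$ denotes the subset of those containing $i$. *)

theory Defs
  imports
    Complex_Main
    "Jordan_Normal_Form.Determinant"
    "Jordan_Normal_Form.DL_Rank"
    "Jordan_Normal_Form.DL_Submatrix"
begin

text \<open>Rows, columns and vector entries are numbered from \<open>0\<close>, following the conventions of
  \<open>Jordan_Normal_Form\<close>: the index range $1, \dots, n$ of the mathematical text is
  \<open>{..<n}\<close> here.\<close>

definition mat_rank :: "complex mat \<Rightarrow> nat" where
  "mat_rank A = vec_space.rank (dim_row A) A"

definition mat_index :: "complex mat \<Rightarrow> nat" where
  "mat_index A = (LEAST k. mat_rank (A ^\<^sub>m (k + 1)) = mat_rank (A ^\<^sub>m k))"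

definition is_drazin_inverse :: "complex mat \<Rightarrow> complex mat \<Rightarrow> bool" where
  "is_drazin_inverse A X \<longleftrightarrow>
     X \<in> carrier_mat (dim_row A) (dim_row A) \<and>
     A ^\<^sub>m (mat_index A + 1) * X = A ^\<^sub>m mat_index A \<and>
     X * A * X = X \<and>
     A * X = X * A"

definition drazin_inverse :: "complex mat \<Rightarrow> complex mat" where
  "drazin_inverse A = (THE X. is_drazin_inverse A X)"

definition drazin_inverse_solution :: "complex mat \<Rightarrow> complex mat \<Rightarrow> complex mat \<Rightarrow> complex mat" where
  "drazin_inverse_solution A B D = drazin_inverse A * D * drazin_inverse B"

text \<open>Row analogue of the library constant \<open>replace_col\<close>, which also takes the
  replacement vector before the position.\<close>

definition replace_row :: "'a mat \<Rightarrow> 'a vec \<Rightarrow> nat \<Rightarrow> 'a mat" where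
  "replace_row A b k =
     mat (dim_row A) (dim_col A) (\<lambda>(i, j). if i = k then b $ j else A $$ (i, j))"

definition principal_minor :: "complex mat \<Rightarrow> nat set \<Rightarrow> complex" where
  "principal_minor M \<alpha> = det (submatrix M \<alpha> \<alpha>)"

text \<open>A strictly increasing sequence of \<open>r\<close> indices is represented by its set of values.
  These definitions serve for both families $I_{r,n}$ and $J_{r,n}$, which coincide.\<close>

definition index_sets :: "nat \<Rightarrow> nat \<Rightarrow> nat set set" where
  "index_sets r n = {\<alpha>. \<alpha> \<subseteq> {..<n} \<and> card \<alpha> = r}"

definition index_sets_with :: "nat \<Rightarrow> nat \<Rightarrow> nat \<Rightarrow> nat set set" where
  "index_sets_with r n i = {\<alpha> \<in> index_sets r n. i \<in> \<alpha>}"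

end

theory Submission
  imports Defs
begin

text \<open>
  Let \<open>M = A\<^sup>k\<^sup>+\<^sup>1\<close> with \<open>k\<close> the index and \<open>r\<close> the common rank. A full rank factorization of
  \<open>A\<^sup>k\<close> yields \<open>M = P C\<close> with \<open>C P\<close> an invertible matrix of order \<open>r\<close>, and writes the Drazin
  inverse both as \<open>P G\<close> and as \<open>H C\<close>. Let \<open>d\<close> be the sum of the principal minors of \<open>M\<close> of
  order \<open>r\<close>, that is, a coefficient of \<open>det (t I + M)\<close>; comparing with \<open>det (t I + C P)\<close> gives
  \<open>d = det (C P) \<noteq> 0\<close>.

  Cramer's rule for \<open>(t I + M) x = t x + M x\<close>, read off at each power of \<open>t\<close>, says that
  \<open>F\<^sub>s (M x) + F\<^sub>s\<^sub>+\<^sub>1 (x) = x\<^sub>i d\<^sub>s\<close>, where \<open>F\<^sub>s (b)\<close> sums the principal minors of order \<open>s\<close>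
  through \<open>i\<close> of \<open>M\<close> with column \<open>i\<close> replaced by \<open>b\<close>, and \<open>d\<^sub>s\<close> sums all principal minors of
  \<open>M\<close> of order \<open>s\<close>. For \<open>x = P w\<close> the matrix with column \<open>i\<close> replaced by \<open>x\<close> still factors
  through dimension \<open>r\<close>, so \<open>F\<^sub>r\<^sub>+\<^sub>1 (x) = 0\<close> and \<open>F\<^sub>r (M x) = x\<^sub>i d\<close>. Applying this to \<open>A\<close> and, after
  transposition, to \<open>B\<close> gives both formulas.
\<close>

section \<open>Principal minors as sums over permutations of the index set\<close>

lemma finite_index_sets [simp]: "finite (index_sets r n)"
  unfolding index_sets_def by (rule finite_subset[of _ "Pow {..<n}"]) auto

lemma finite_index_sets_with [simp]: "finite (index_sets_with r n i)"
  unfolding index_sets_with_def by simp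

lemma bij_betw_pick:
  assumes "finite I"
  shows "bij_betw (pick I) {0..<card I} I"
proof -
  have inj: "inj_on (pick I) {0..<card I}"
    by (rule inj_onI) (metis atLeastLessThan_iff card_pick_le)
  moreover have "pick I ` {0..<card I} \<subseteq> I"
    using pick_in_set_le by auto
  ultimately have "pick I ` {0..<card I} = I"
    using assms by (intro card_subset_eq) (auto simp: card_image)
  with inj show ?thesis by (simp add: bij_betw_def)
qed

text \<open>Conjugation by the enumeration \<open>pick \<alpha>\<close> turns permutations of
  positions into permutations of \<open>\<alpha>\<close> and preserves the sign. After this lemma
  minors are handled through entries of \<open>N\<close> itself, with no renumbering of rows and
  columns.\<close>

lemma principal_minor_Leibniz:
  assumes N: "N \<in> carrier_mat n n" and \<alpha>: "\<alpha> \<subseteq> {..<n}"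
  shows "principal_minor N \<alpha> =
    (\<Sum>p | p permutes \<alpha>. signof p * (\<Prod>i\<in>\<alpha>. N $$ (i, p i)))"
proof -
  let ?k = "card \<alpha>" and ?f = "pick \<alpha>"
  let ?U = "{0..<?k}"
  have fin: "finite \<alpha>" using \<alpha> finite_subset by blast
  have bij: "bij_betw ?f ?U \<alpha>" by (rule bij_betw_pick[OF fin])
  have inj: "inj_on ?f ?U" using bij by (rule bij_betw_imp_inj_on)
  have eq: "{i. i < n \<and> i \<in> \<alpha>} = \<alpha>" using \<alpha> by auto
  have S: "submatrix N \<alpha> \<alpha> = mat ?k ?k (\<lambda>(i, j). N $$ (?f i, ?f j))"
    using N by (simp add: submatrix_def eq)
  have "principal_minor N \<alpha> =
    (\<Sum>p | p permutes ?U. signof p * (\<Prod>i = 0..<?k. N $$ (?f i, ?f (p i))))"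
    unfolding principal_minor_def S
    by (subst det_def'[of _ ?k])
       (auto intro!: sum.cong prod.cong dest: permutes_in_image)
  also have "\<dots> = (\<Sum>p | p permutes ?U. signof (map_permutation ?U ?f p) *
      (\<Prod>i\<in>\<alpha>. N $$ (i, map_permutation ?U ?f p i)))"
  proof (rule sum.cong[OF refl])
    fix p assume "p \<in> {p. p permutes ?U}"
    then have p: "p permutes ?U" by simp
    have "(\<Prod>i\<in>\<alpha>. N $$ (i, map_permutation ?U ?f p i)) =
        (\<Prod>i\<in>?U. N $$ (?f i, map_permutation ?U ?f p (?f i)))"
      by (rule prod.reindex_bij_betw[OF bij, symmetric])
    also have "\<dots> = (\<Prod>i\<in>?U. N $$ (?f i, ?f (p i)))"
      by (rule prod.cong) (auto simp: map_permutation_apply[OF inj])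
    finally show "signof p * (\<Prod>i = 0..<?k. N $$ (?f i, ?f (p i))) =
        signof (map_permutation ?U ?f p) * (\<Prod>i\<in>\<alpha>. N $$ (i, map_permutation ?U ?f p i))"
      by (simp add: sign_map_permutation[OF inj p])
  qed
  also have "\<dots> = (\<Sum>p | p permutes \<alpha>. signof p * (\<Prod>i\<in>\<alpha>. N $$ (i, p i)))"
  proof (rule sum.reindex_bij_betw[where h = "map_permutation ?U ?f"])
    have "bij_betw (\<lambda>p x. if x \<in> \<alpha> then ?f (p (inv_into ?U ?f x)) else x)
        {p. p permutes ?U} {p. p permutes \<alpha>}"
      by (rule bij_betw_permutations[OF bij])
    moreover have "(\<lambda>x. if x \<in> \<alpha> then ?f (p (inv_into ?U ?f x)) else x) = map_permutation ?U ?f p" for p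
      using bij by (auto simp: map_permutation_def restrict_id_def bij_betw_def fun_eq_iff)
    ultimately show "bij_betw (map_permutation ?U ?f) {p. p permutes ?U} {p. p permutes \<alpha>}"
      by simp
  qed
  finally show ?thesis .
qed

lemma principal_minor_cong:
  assumes "N \<in> carrier_mat n n" "N' \<in> carrier_mat n n" "\<alpha> \<subseteq> {..<n}"
    and "\<And>i j. i \<in> \<alpha> \<Longrightarrow> j \<in> \<alpha> \<Longrightarrow> N $$ (i, j) = N' $$ (i, j)"
  shows "principal_minor N \<alpha> = principal_minor N' \<alpha>"
  unfolding principal_minor_Leibniz[OF assms(1,3)] principal_minor_Leibniz[OF assms(2,3)]
  by (auto intro!: sum.cong prod.cong simp: assms(4) permutes_in_image)

text \<open>Every permutation of \<open>\<alpha>\<close> sends some index to \<open>i\<close>, so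
  every Leibniz product contains a factor from column \<open>i\<close>.\<close>

lemma principal_minor_zero_col:
  assumes N: "N \<in> carrier_mat n n" and \<alpha>: "\<alpha> \<subseteq> {..<n}" and i: "i \<in> \<alpha>"
    and zero: "\<And>j. j < n \<Longrightarrow> N $$ (j, i) = 0"
  shows "principal_minor N \<alpha> = 0"
  unfolding principal_minor_Leibniz[OF N \<alpha>]
proof (intro sum.neutral ballI)
  fix p assume "p \<in> {p. p permutes \<alpha>}"
  then have p: "p permutes \<alpha>" by simp
  then obtain j where "j \<in> \<alpha>" "p j = i"
    using i by (metis permutes_image imageE)
  moreover have "finite \<alpha>" using \<alpha> finite_subset by blast
  ultimately have "(\<Prod>j\<in>\<alpha>. N $$ (j, p j)) = 0"
    using zero \<alpha> by (intro prod_zero) auto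
  then show "signof p * (\<Prod>j\<in>\<alpha>. N $$ (j, p j)) = 0" by simp
qed

lemma principal_minor_transpose:
  assumes "N \<in> carrier_mat n n" "\<alpha> \<subseteq> {..<n}"
  shows "principal_minor N\<^sup>T \<alpha> = principal_minor N \<alpha>"
proof -
  have eq: "{i. i < n \<and> i \<in> \<alpha>} = \<alpha>" using assms by auto
  have "pick \<alpha> i < n" if "i < card \<alpha>" for i
    using pick_in_set_le[OF that] assms by auto
  then have "submatrix N\<^sup>T \<alpha> \<alpha> = (submatrix N \<alpha> \<alpha>)\<^sup>T"
    using assms by (auto simp: submatrix_def eq intro!: eq_matI)
  moreover have "submatrix N \<alpha> \<alpha> \<in> carrier_mat (card \<alpha>) (card \<alpha>)"
    using assms by (simp add: submatrix_def eq)
  ultimately show ?thesis unfolding principal_minor_def by (simp add: det_transpose)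
qed

lemma principal_minor_full:
  assumes "N \<in> carrier_mat n n"
  shows "principal_minor N {..<n} = det N"
  unfolding principal_minor_Leibniz[OF assms order_refl] det_def'[OF assms]
  by (simp add: atLeast0LessThan)

section \<open>The coefficients of det (t I + N)\<close>

lemma sum_Pow_lessThan_by_card:
  "(\<Sum>\<alpha>\<in>Pow {..<n}. f \<alpha>) = (\<Sum>s\<le>n. \<Sum>\<alpha>\<in>index_sets s n. f \<alpha>)"
proof -
  have "(\<Sum>s\<le>n. \<Sum>\<alpha>\<in>index_sets s n. f \<alpha>) = sum f (\<Union>s\<in>{..n}. index_sets s n)"
    by (rule sum.UNION_disjoint[symmetric]) (auto simp: index_sets_def)
  also have "(\<Union>s\<in>{..n}. index_sets s n) = Pow {..<n}"
    using subset_eq_atLeast0_lessThan_card by (fastforce simp: index_sets_def atLeast0LessThan)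
  finally show ?thesis by simp
qed

text \<open>In the Leibniz formula the diagonal shift contributes \<open>t\<close> exactly at the
  fixed points of \<open>p\<close>. The product is multiplied out over the set
  \<open>\<alpha>\<close> of rows that supply an entry of \<open>N\<close>; the remaining rows
  supply \<open>t\<close> and must be fixed by \<open>p\<close>, which leaves the Leibniz sum of the
  minor on \<open>\<alpha>\<close>.\<close>

lemma det_shift_expansion:
  fixes t :: complex
  assumes N: "N \<in> carrier_mat n n"
  shows "det (t \<cdot>\<^sub>m 1\<^sub>m n + N) = (\<Sum>s\<le>n. (\<Sum>\<alpha>\<in>index_sets s n. principal_minor N \<alpha>) * t ^ (n - s))"
proof -
  let ?P = "{p. p permutes {0..<n}}"
  have c: "t \<cdot>\<^sub>m 1\<^sub>m n + N \<in> carrier_mat n n" using N by simp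
  have entry: "(t \<cdot>\<^sub>m 1\<^sub>m n + N) $$ (i, p i) = N $$ (i, p i) + (if p i = i then t else 0)"
    if "p \<in> ?P" "i < n" for p i
  proof -
    have "p i < n" using that permutes_in_image[of p "{0..<n}" i] by auto
    then show ?thesis using that N by auto
  qed
  have "det (t \<cdot>\<^sub>m 1\<^sub>m n + N) = (\<Sum>p\<in>?P. signof p * (\<Prod>i\<in>{..<n}. N $$ (i, p i) + (if p i = i then t else 0)))"
    unfolding det_def'[OF c] by (intro sum.cong refl arg_cong2[of _ _ _ _ "(*)"] prod.cong)
       (auto simp: atLeast0LessThan entry)
  also have "\<dots> = (\<Sum>p\<in>?P. \<Sum>\<alpha>\<in>Pow {..<n}. signof p * (\<Prod>i\<in>\<alpha>. N $$ (i, p i)) *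
      (\<Prod>i\<in>{..<n} - \<alpha>. if p i = i then t else 0))"
    by (simp add: prod_add sum_distrib_left mult.assoc)
  also have "\<dots> = (\<Sum>\<alpha>\<in>Pow {..<n}. \<Sum>p\<in>?P. signof p * (\<Prod>i\<in>\<alpha>. N $$ (i, p i)) *
      (\<Prod>i\<in>{..<n} - \<alpha>. if p i = i then t else 0))"
    by (rule sum.swap)
  also have "\<dots> = (\<Sum>\<alpha>\<in>Pow {..<n}. principal_minor N \<alpha> * t ^ (n - card \<alpha>))"
  proof (rule sum.cong[OF refl])
    fix \<alpha> assume "\<alpha> \<in> Pow {..<n}"
    then have \<alpha>: "\<alpha> \<subseteq> {..<n}" by simp
    have card: "card ({..<n} - \<alpha>) = n - card \<alpha>"
      using \<alpha> by (simp add: card_Diff_subset finite_subset)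
    have "(\<Sum>p\<in>?P. signof p * (\<Prod>i\<in>\<alpha>. N $$ (i, p i)) * (\<Prod>i\<in>{..<n} - \<alpha>. if p i = i then t else 0))
      = (\<Sum>p | p permutes \<alpha>. signof p * (\<Prod>i\<in>\<alpha>. N $$ (i, p i)) * (\<Prod>i\<in>{..<n} - \<alpha>. if p i = i then t else 0))"
    \<comment> \<open>A permutation that moves a point outside \<open>\<alpha>\<close> picks up a
      factor 0 there, so only the permutations of \<open>\<alpha>\<close> survive.\<close>
    proof (rule sum.mono_neutral_right)
      show "finite ?P" by (simp add: finite_permutations)
      show "{p. p permutes \<alpha>} \<subseteq> ?P" using \<alpha> permutes_subset by (auto simp: atLeast0LessThan)
      show "\<forall>p\<in>?P - {p. p permutes \<alpha>}. signof p * (\<Prod>i\<in>\<alpha>. N $$ (i, p i)) *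
          (\<Prod>i\<in>{..<n} - \<alpha>. if p i = i then t else 0) = 0"
      proof
        fix p assume p: "p \<in> ?P - {p. p permutes \<alpha>}"
        then obtain i where "i \<in> {..<n} - \<alpha>" "p i \<noteq> i"
          using permutes_superset[of p "{0..<n}" \<alpha>] by (auto simp: atLeast0LessThan)
        then have "(\<Prod>i\<in>{..<n} - \<alpha>. if p i = i then t else 0) = 0"
          by (intro prod_zero) auto
        then show "signof p * (\<Prod>i\<in>\<alpha>. N $$ (i, p i)) * (\<Prod>i\<in>{..<n} - \<alpha>. if p i = i then t else 0) = 0"
          by simp
      qed
    qed
    also have "\<dots> = (\<Sum>p | p permutes \<alpha>. signof p * (\<Prod>i\<in>\<alpha>. N $$ (i, p i)) * t ^ (n - card \<alpha>))"
    proof (intro sum.cong refl arg_cong2[of _ _ _ _ "(*)"])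
      fix p assume "p \<in> {p. p permutes \<alpha>}"
      then have "(\<Prod>i\<in>{..<n} - \<alpha>. if p i = i then t else 0) = (\<Prod>i\<in>{..<n} - \<alpha>. t)"
        by (intro prod.cong) (auto simp: permutes_not_in)
      then show "(\<Prod>i\<in>{..<n} - \<alpha>. if p i = i then t else 0) = t ^ (n - card \<alpha>)"
        by (simp add: card)
    qed
    finally show "(\<Sum>p\<in>?P. signof p * (\<Prod>i\<in>\<alpha>. N $$ (i, p i)) * (\<Prod>i\<in>{..<n} - \<alpha>. if p i = i then t else 0))
      = principal_minor N \<alpha> * t ^ (n - card \<alpha>)"
      by (simp add: principal_minor_Leibniz[OF N \<alpha>] sum_distrib_right)
  qed
  also have "\<dots> = (\<Sum>s\<le>n. \<Sum>\<alpha>\<in>index_sets s n. principal_minor N \<alpha> * t ^ (n - card \<alpha>))"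
    by (rule sum_Pow_lessThan_by_card)
  also have "\<dots> = (\<Sum>s\<le>n. (\<Sum>\<alpha>\<in>index_sets s n. principal_minor N \<alpha>) * t ^ (n - s))"
    by (intro sum.cong refl) (auto simp: sum_distrib_right index_sets_def)
  finally show ?thesis .
qed

section \<open>Sums of principal minors of a product of rectangular matrices\<close>

abbreviation minor_sum :: "nat \<Rightarrow> nat \<Rightarrow> complex mat \<Rightarrow> complex" where
  "minor_sum s n N \<equiv> \<Sum>\<beta>\<in>index_sets s n. principal_minor N \<beta>"

abbreviation minor_sum_with :: "nat \<Rightarrow> nat \<Rightarrow> nat \<Rightarrow> complex mat \<Rightarrow> complex" where
  "minor_sum_with s n i N \<equiv> \<Sum>\<beta>\<in>index_sets_with s n i. principal_minor N \<beta>"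

lemma det_shift_mult_commute:
  fixes t :: "'a :: idom"
  assumes P: "P \<in> carrier_mat n r" and Z: "Z \<in> carrier_mat r n"
  shows "t ^ r * det (t \<cdot>\<^sub>m 1\<^sub>m n + P * Z) = t ^ n * det (t \<cdot>\<^sub>m 1\<^sub>m r + Z * P)"
proof -
  let ?F = "four_block_mat (t \<cdot>\<^sub>m 1\<^sub>m n) P (- Z) (1\<^sub>m r)"
  let ?G = "four_block_mat (1\<^sub>m n) (0\<^sub>m n r) Z (1\<^sub>m r)"
  let ?H = "four_block_mat (1\<^sub>m n) (0\<^sub>m n r) Z (t \<cdot>\<^sub>m 1\<^sub>m r)"
  have F: "?F \<in> carrier_mat (n + r) (n + r)" using P Z by (intro four_block_carrier_mat) auto
  have G: "?G \<in> carrier_mat (n + r) (n + r)" using Z by (intro four_block_carrier_mat) auto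
  have H: "?H \<in> carrier_mat (n + r) (n + r)" using Z by (intro four_block_carrier_mat) auto
  have FG: "?F * ?G = four_block_mat (t \<cdot>\<^sub>m 1\<^sub>m n + P * Z) P (0\<^sub>m r n) (1\<^sub>m r)"
    using P Z
    by (subst mult_four_block_mat[where ?n1.0 = n and ?n2.0 = r])
       (auto simp: uminus_l_inv_mat)
  have HF: "?H * ?F = four_block_mat (t \<cdot>\<^sub>m 1\<^sub>m n) P (0\<^sub>m r n) (t \<cdot>\<^sub>m 1\<^sub>m r + Z * P)"
    using P Z
    by (subst mult_four_block_mat[where ?n1.0 = n and ?n2.0 = r])
       (auto intro!: cong_four_block_mat eq_matI simp: comm_add_mat)
  have dG: "det ?G = 1"
    using Z by (subst det_four_block_mat_upper_right_zero[of _ n _ r]) auto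
  have dH: "det ?H = t ^ r"
    using Z by (subst det_four_block_mat_upper_right_zero[of _ n _ r]) auto
  have dFG: "det (?F * ?G) = det (t \<cdot>\<^sub>m 1\<^sub>m n + P * Z)"
    unfolding FG using P Z by (subst det_four_block_mat_lower_left_zero[of _ n _ r]) auto
  have dHF: "det (?H * ?F) = t ^ n * det (t \<cdot>\<^sub>m 1\<^sub>m r + Z * P)"
    unfolding HF using P Z by (subst det_four_block_mat_lower_left_zero[of _ n _ r]) auto
  show ?thesis
    using dG dH dFG dHF det_mult[OF F G] det_mult[OF H F] by simp
qed

text \<open>After multiplication by the outer power, both \<open>a s\<close> and \<open>b s\<close>
  belong to the exponent \<open>n + r - s\<close>, so the claim is a comparison of coefficients of
  two polynomial functions. The reversed exponents match the shape of
  \<open>det_shift_expansion\<close>.\<close>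

lemma reversed_polynomial_coeffs_eq:
  fixes a b :: "nat \<Rightarrow> complex"
  assumes eq: "\<And>t. t ^ r * (\<Sum>s\<le>n. a s * t ^ (n - s)) = t ^ n * (\<Sum>s\<le>r. b s * t ^ (r - s))"
    and s: "s \<le> n"
  shows "a s = (if s \<le> r then b s else 0)"
proof -
  have shift: "t ^ p * (\<Sum>s\<le>q. c s * t ^ (q - s)) =
      (\<Sum>i\<le>n + r. (if p \<le> i then c (n + r - i) else 0) * t ^ i)"
    if "p + q = n + r" for p q t and c :: "nat \<Rightarrow> complex"
  proof -
    have "t ^ p * (\<Sum>s\<le>q. c s * t ^ (q - s)) = (\<Sum>i\<in>{p..n + r}. c (n + r - i) * t ^ i)"
      unfolding sum_distrib_left using that
      by (intro sum.reindex_bij_witness[of _ "\<lambda>i. n + r - i" "\<lambda>s. n + r - s"])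
         (auto simp: mult.left_commute simp flip: power_add intro!: arg_cong2[of _ _ _ _ "(^)"])
    also have "\<dots> = (\<Sum>i\<le>n + r. (if p \<le> i then c (n + r - i) else 0) * t ^ i)"
      by (rule sum.mono_neutral_cong_left) auto
    finally show ?thesis .
  qed
  have "\<forall>t. (\<Sum>i\<le>n + r. (if r \<le> i then a (n + r - i) else 0) * t ^ i) =
      (\<Sum>i\<le>n + r. (if n \<le> i then b (n + r - i) else 0) * t ^ i)"
    using eq by (simp flip: shift)
  then have "(if r \<le> n + r - s then a (n + r - (n + r - s)) else 0) =
      (if n \<le> n + r - s then b (n + r - (n + r - s)) else 0)"
    unfolding polyfun_eq_coeffs using diff_le_self by blast
  then show ?thesis using s by (auto split: if_splits)
qed

lemma card_le_of_subset_lessThan: "\<beta> \<subseteq> {..<n} \<Longrightarrow> card \<beta> \<le> n"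
  using card_mono[of "{..<n}" \<beta>] by simp

lemma minor_sum_beyond: "n < s \<Longrightarrow> minor_sum s n N = 0"
proof -
  assume "n < s"
  then have "index_sets s n = {}"
    using card_le_of_subset_lessThan by (auto simp: index_sets_def not_le[symmetric])
  then show ?thesis by simp
qed

text \<open>The characteristic polynomials of \<open>P * Z\<close> and \<open>Z * P\<close> differ
  only by a power of the variable, so their coefficients agree where both exist and the surplus ones
  vanish.\<close>

lemma minor_sum_mult:
  assumes P: "P \<in> carrier_mat n r" and Z: "Z \<in> carrier_mat r n" and s: "s \<le> n"
  shows "minor_sum s n (P * Z) = (if s \<le> r then minor_sum s r (Z * P) else 0)"
proof (rule reversed_polynomial_coeffs_eq[OF _ s])
  fix t :: complex
  have "P * Z \<in> carrier_mat n n" "Z * P \<in> carrier_mat r r" using P Z by auto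
  then show "t ^ r * (\<Sum>s\<le>n. minor_sum s n (P * Z) * t ^ (n - s)) =
      t ^ n * (\<Sum>s\<le>r. minor_sum s r (Z * P) * t ^ (r - s))"
    using det_shift_mult_commute[OF P Z, of t] by (simp only: det_shift_expansion)
qed

lemma minor_sum_mult_eq_0:
  assumes "P \<in> carrier_mat n r" "Z \<in> carrier_mat r n" "r < s"
  shows "minor_sum s n (P * Z) = 0"
  using minor_sum_mult[OF assms(1,2), of s] minor_sum_beyond[of n s "P * Z"] assms(3)
  by (cases "s \<le> n") auto

lemma minor_sum_mult_eq_det:
  assumes P: "P \<in> carrier_mat n r" and Z: "Z \<in> carrier_mat r n" and "r \<le> n"
  shows "minor_sum r n (P * Z) = det (Z * P)"
proof -
  have "index_sets r r = {{..<r}}"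
    using card_subset_eq[of "{..<r}"] by (auto simp: index_sets_def)
  moreover have "Z * P \<in> carrier_mat r r" using P Z by simp
  ultimately show ?thesis
    using minor_sum_mult[OF P Z \<open>r \<le> n\<close>] by (simp add: principal_minor_full)
qed

section \<open>Column replacement and Cramer's rule, coefficient by coefficient\<close>

lemma replace_col_carrier [simp]:
  "A \<in> carrier_mat n m \<Longrightarrow> replace_col A b i \<in> carrier_mat n m"
  unfolding replace_col_def by auto

lemma det_replace_col:
  assumes K: "K \<in> carrier_mat n n" and i: "i < n"
  shows "det (replace_col K b i) = (\<Sum>j<n. b $ j * cofactor K j i)"
proof -
  have "det (replace_col K b i) = (\<Sum>j<n. replace_col K b i $$ (j, i) * cofactor (replace_col K b i) j i)"
    using K i by (intro laplace_expansion_column) auto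
  also have "\<dots> = (\<Sum>j<n. b $ j * cofactor K j i)"
  proof (rule sum.cong[OF refl])
    fix j assume j: "j \<in> {..<n}"
    have "mat_delete (replace_col K b i) j i = mat_delete K j i"
      using K i j by (intro eq_matI) (auto simp: mat_delete_def replace_col_def)
    then show "replace_col K b i $$ (j, i) * cofactor (replace_col K b i) j i = b $ j * cofactor K j i"
      using K i j by (simp add: cofactor_def replace_col_def)
  qed
  finally show ?thesis .
qed

lemma det_replace_col_linear:
  assumes "K \<in> carrier_mat n n" "i < n" "u \<in> carrier_vec n" "v \<in> carrier_vec n"
  shows "det (replace_col K (c \<cdot>\<^sub>v u + v) i) = c * det (replace_col K u i) + det (replace_col K v i)"
  using assms
  by (simp add: det_replace_col sum_distrib_left distrib_right sum.distrib mult.assoc)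

text \<open>Setting column \<open>i\<close> to zero kills exactly the minors through
  \<open>i\<close> and leaves the others unchanged. Facts about full sums of minors thereby become
  available for the sums through \<open>i\<close>.\<close>

lemma minor_sum_with_replace_col:
  assumes M: "M \<in> carrier_mat n n" and i: "i < n"
  shows "minor_sum_with s n i (replace_col M b i) =
    minor_sum s n (replace_col M b i) - minor_sum s n (replace_col M (0\<^sub>v n) i)"
proof -
  let ?N = "replace_col M b i" and ?Z = "replace_col M (0\<^sub>v n) i"
  let ?R = "{\<beta> \<in> index_sets s n. i \<notin> \<beta>}"
  have "index_sets s n = index_sets_with s n i \<union> ?R"
    by (auto simp: index_sets_with_def)
  then have split: "minor_sum s n N = minor_sum_with s n i N + (\<Sum>\<beta>\<in>?R. principal_minor N \<beta>)" for N
    by (subst (asm) eq_commute, elim subst, intro sum.union_disjoint)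
       (auto simp: index_sets_with_def)
  have "minor_sum_with s n i ?Z = 0"
  proof (rule sum.neutral, rule ballI)
    fix \<beta> assume "\<beta> \<in> index_sets_with s n i"
    then show "principal_minor ?Z \<beta> = 0"
      using M i by (intro principal_minor_zero_col[of _ n _ i])
        (auto simp: index_sets_with_def index_sets_def replace_col_def)
  qed
  moreover have "(\<Sum>\<beta>\<in>?R. principal_minor ?N \<beta>) = (\<Sum>\<beta>\<in>?R. principal_minor ?Z \<beta>)"
  proof (rule sum.cong[OF refl])
    fix \<beta> assume \<beta>: "\<beta> \<in> ?R"
    show "principal_minor ?N \<beta> = principal_minor ?Z \<beta>"
    proof (rule principal_minor_cong[of _ n])
      fix j l assume "j \<in> \<beta>" "l \<in> \<beta>"
      then have "j < n" "l < n" "l \<noteq> i" using \<beta> by (auto simp: index_sets_def)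
      then show "?N $$ (j, l) = ?Z $$ (j, l)" using M by (simp add: replace_col_def)
    qed (use \<beta> M in \<open>auto simp: index_sets_def\<close>)
  qed
  ultimately show ?thesis by (simp add: split[of ?N] split[of ?Z])
qed

text \<open>Shifting after the replacement amounts to replacing column \<open>i\<close> of the
  shifted matrix by \<open>c\<close> plus \<open>t\<close> times a unit vector. In the difference of
  the cases c = b and c = 0 the unit vector contribution cancels by linearity in that
  column.\<close>

lemma det_replace_col_shift_expansion:
  fixes t :: complex
  assumes M: "M \<in> carrier_mat n n" and i: "i < n" and b: "b \<in> carrier_vec n"
  shows "det (replace_col (t \<cdot>\<^sub>m 1\<^sub>m n + M) b i) =
    (\<Sum>s\<le>n. minor_sum_with s n i (replace_col M b i) * t ^ (n - s))"
proof -
  let ?K = "t \<cdot>\<^sub>m 1\<^sub>m n + M"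
  have K: "?K \<in> carrier_mat n n" using M by simp
  have shift: "t \<cdot>\<^sub>m 1\<^sub>m n + replace_col M c i = replace_col ?K (t \<cdot>\<^sub>v unit_vec n i + c) i"
    if "c \<in> carrier_vec n" for c
    using M i that by (intro eq_matI) (auto simp: replace_col_def)
  have "(\<Sum>s\<le>n. minor_sum_with s n i (replace_col M b i) * t ^ (n - s)) =
      det (t \<cdot>\<^sub>m 1\<^sub>m n + replace_col M b i) - det (t \<cdot>\<^sub>m 1\<^sub>m n + replace_col M (0\<^sub>v n) i)"
    using M by (simp add: minor_sum_with_replace_col[OF M i] det_shift_expansion[of _ n]
        left_diff_distrib sum_subtractf)
  also have "\<dots> = det (replace_col ?K b i) - det (replace_col ?K (0\<^sub>v n) i)"
    unfolding shift[OF b] shift[OF zero_carrier_vec] det_replace_col_linear[OF K i unit_vec_carrier b]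
      det_replace_col_linear[OF K i unit_vec_carrier zero_carrier_vec] by simp
  also have "det (replace_col ?K (0\<^sub>v n) i) = 0"
    by (simp add: det_replace_col[OF K i])
  finally show ?thesis by simp
qed

lemma minor_sum_with_beyond:
  assumes "s = 0 \<or> n < s"
  shows "minor_sum_with s n i N = 0"
proof -
  have "index_sets_with s n i = {}"
    using assms card_le_of_subset_lessThan finite_subset[OF _ finite_lessThan]
    by (auto simp: index_sets_with_def index_sets_def not_le[symmetric])
  then show ?thesis by simp
qed

lemma minor_sum_with_Cramer:
  assumes M: "M \<in> carrier_mat n n" and i: "i < n" and x: "x \<in> carrier_vec n" and s: "s \<le> n"
  shows "minor_sum_with s n i (replace_col M (M *\<^sub>v x) i) +
    minor_sum_with (Suc s) n i (replace_col M x i) = x $ i * minor_sum s n M"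
proof -
  let ?F = "\<lambda>s b. minor_sum_with s n i (replace_col M b i)"
  let ?a = "\<lambda>s. ?F s (M *\<^sub>v x) + ?F (Suc s) x" and ?b = "\<lambda>s. x $ i * minor_sum s n M"
  have Mx: "M *\<^sub>v x \<in> carrier_vec n" using M x by simp
  have "?a s = (if s \<le> n then ?b s else 0)"
  proof (rule reversed_polynomial_coeffs_eq[OF _ s])
    fix t :: complex
    let ?K = "t \<cdot>\<^sub>m 1\<^sub>m n + M"
    have K: "?K \<in> carrier_mat n n" using M by simp
    have Kx: "?K *\<^sub>v x = t \<cdot>\<^sub>v x + M *\<^sub>v x"
      using M x by (subst add_mult_distrib_mat_vec[of _ n n]) (auto intro!: eq_vecI)
    have "t * det (replace_col ?K x i) = (\<Sum>s\<le>n. ?F s x * t ^ (Suc n - s))"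
      unfolding det_replace_col_shift_expansion[OF M i x] sum_distrib_left
      by (intro sum.cong) (auto simp: Suc_diff_le)
    \<comment> \<open>The new term s = n + 1 is an empty sum. In the next step the term s = 0 is
      dropped, since the empty set does not contain \<open>i\<close>; the factor \<open>t\<close>
      has thus raised the order of the minors by one.\<close>
    also have "\<dots> = (\<Sum>s\<le>Suc n. ?F s x * t ^ (Suc n - s))"
      by (simp add: minor_sum_with_beyond)
    also have "\<dots> = (\<Sum>s\<le>n. ?F (Suc s) x * t ^ (n - s))"
      by (subst sum.atMost_Suc_shift) (simp add: minor_sum_with_beyond)
    finally have "(\<Sum>s\<le>n. ?a s * t ^ (n - s)) =
        t * det (replace_col ?K x i) + det (replace_col ?K (M *\<^sub>v x) i)"
      by (simp add: det_replace_col_shift_expansion[OF M i Mx] distrib_right sum.distrib)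
    also have "\<dots> = det (replace_col ?K (?K *\<^sub>v x) i)"
      unfolding Kx by (rule det_replace_col_linear[OF K i x Mx, symmetric])
    also have "\<dots> = x $ i * det ?K" by (rule cramer_lemma_mat[OF K x i])
    also have "\<dots> = (\<Sum>s\<le>n. ?b s * t ^ (n - s))"
      by (simp add: det_shift_expansion[OF M] mult.assoc flip: sum_distrib_left)
    \<comment> \<open>The comparison lemma is used with both sizes equal to \<open>n\<close>, whence
      the common factor \<open>t ^ n\<close>.\<close>
    finally show "t ^ n * (\<Sum>s\<le>n. ?a s * t ^ (n - s)) = t ^ n * (\<Sum>s\<le>n. ?b s * t ^ (n - s))"
      by simp
  qed
  then show ?thesis using s by simp
qed

lemma replace_col_mult:
  assumes "P \<in> carrier_mat n r" "C \<in> carrier_mat r m" "w \<in> carrier_vec r"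
  shows "replace_col (P * C) (P *\<^sub>v w) i = P * replace_col C w i"
  using assms
  by (intro eq_matI) (auto simp: replace_col_def scalar_prod_def intro!: sum.cong)

text \<open>This is the Cramer identity at order \<open>r\<close>. Its term of order
  \<open>r + 1\<close> is a difference of two sums of minors, for column \<open>i\<close> replaced
  by \<open>P *\<^sub>v w\<close> and by zero; both matrices still have \<open>P\<close> as left
  factor, so both sums vanish.\<close>

lemma minor_sum_with_replace_col_mult:
  assumes P: "P \<in> carrier_mat n r" and C: "C \<in> carrier_mat r n" and w: "w \<in> carrier_vec r"
    and "r \<le> n" and i: "i < n"
  shows "minor_sum_with r n i (replace_col (P * C) (P * C *\<^sub>v (P *\<^sub>v w)) i) =
    (P *\<^sub>v w) $ i * minor_sum r n (P * C)"
proof -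
  have M: "P * C \<in> carrier_mat n n" and Pw: "P *\<^sub>v w \<in> carrier_vec n" using P C w by auto
  have "P *\<^sub>v 0\<^sub>v r = 0\<^sub>v n" using P by (intro eq_vecI) auto
  then have "replace_col (P * C) (0\<^sub>v n) i = P * replace_col C (0\<^sub>v r) i"
    using replace_col_mult[OF P C zero_carrier_vec, of i] by simp
  then have "minor_sum_with (Suc r) n i (replace_col (P * C) (P *\<^sub>v w) i) = 0"
    using P C w by (subst minor_sum_with_replace_col[OF M i])
      (simp add: replace_col_mult[OF P C w] minor_sum_mult_eq_0[of _ n r])
  then show ?thesis using minor_sum_with_Cramer[OF M i Pw \<open>r \<le> n\<close>] by simp
qed

section \<open>Matrix algebra and full rank factorization\<close>

lemma mat_assoc:
  fixes A B C :: "'a :: semiring_0 mat"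
  assumes "dim_col A = dim_row B" "dim_col B = dim_row C"
  shows "A * B * C = A * (B * C)"
  using assms
  by (intro assoc_mult_mat[of _ "dim_row A" "dim_col A" _ "dim_col B" _ "dim_col C"]) auto

text \<open>The intertwining form serves twice: with \<open>T\<close> equal to \<open>A\<close> it
  says that powers commute with what commutes with \<open>A\<close>, and with a rank factor
  \<open>P\<close> it transports powers of \<open>A\<close> to a smaller matrix.\<close>

lemma pow_mat_mult_commute:
  assumes A: "A \<in> carrier_mat n n" and P: "P \<in> carrier_mat n r" and T: "T \<in> carrier_mat r r"
    and comm: "A * P = P * T"
  shows "A ^\<^sub>m j * P = P * T ^\<^sub>m j"
proof (induction j)
  case 0
  then show ?case using A P T by simp
next
  case (Suc j)
  have d: "A ^\<^sub>m j \<in> carrier_mat n n" "T ^\<^sub>m j \<in> carrier_mat r r"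
    using A T by (auto intro: pow_carrier_mat)
  have "A ^\<^sub>m Suc j * P = A ^\<^sub>m j * P * T"
    using A P T d by (simp add: mat_assoc comm)
  also have "\<dots> = P * T ^\<^sub>m Suc j"
    using A P T d by (simp add: Suc mat_assoc)
  finally show ?case .
qed

lemma eq_mat_if_mult_left_eq:
  fixes P :: "'a :: ring mat"
  assumes P: "P \<in> carrier_mat n r" and inj: "\<And>v. v \<in> carrier_vec r \<Longrightarrow> P *\<^sub>v v = 0\<^sub>v n \<Longrightarrow> v = 0\<^sub>v r"
    and U: "U \<in> carrier_mat r m" and V: "V \<in> carrier_mat r m" and eq: "P * U = P * V"
  shows "U = V"
proof (rule eq_matI)
  fix i j assume ij: "i < dim_row V" "j < dim_col V"
  have c: "col U j \<in> carrier_vec r" "col V j \<in> carrier_vec r"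
    using U V ij by auto
  have "P *\<^sub>v col U j = P *\<^sub>v col V j"
    using arg_cong[OF eq, of "\<lambda>M. col M j"] col_mult2[OF P U, of j] col_mult2[OF P V, of j] V ij
    by (metis carrier_matD(2))
  then have "P *\<^sub>v (col U j - col V j) = 0\<^sub>v n"
    using P c by (simp add: mult_minus_distrib_mat_vec)
  then have "col U j - col V j = 0\<^sub>v r" using c by (intro inj) auto
  then have "(col U j - col V j) $ i = 0" using ij V by simp
  then show "U $$ (i, j) = V $$ (i, j)" using U V ij c by simp
qed (use U V in auto)

lemma inverse_mat_exists:
  fixes Z :: "'a :: field mat"
  assumes Z: "Z \<in> carrier_mat r r" and "det Z \<noteq> 0"
  obtains Y where "Y \<in> carrier_mat r r" "Z * Y = 1\<^sub>m r" "Y * Z = 1\<^sub>m r"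
  using det_non_zero_imp_unit[OF assms] by (auto simp: Units_def ring_mat_def)

text \<open>\<open>P\<close> collects a maximal independent set of columns of \<open>A\<close>,
  \<open>Q\<close> holds the coordinates of all columns in that basis, and \<open>J\<close> selects
  the chosen columns. Then \<open>P * (Q * J) = A * J = P\<close>, and cancelling the injective
  \<open>P\<close> gives \<open>Q * J = 1\<^sub>m (rank A)\<close>.\<close>

lemma (in vec_space) rank_factorization:
  assumes A: "A \<in> carrier_mat n m"
  obtains P Q J where "P \<in> carrier_mat n (rank A)" "Q \<in> carrier_mat (rank A) m"
    "J \<in> carrier_mat m (rank A)" "A = P * Q" "P = A * J" "Q * J = 1\<^sub>m (rank A)"
    "\<And>v. v \<in> carrier_vec (rank A) \<Longrightarrow> P *\<^sub>v v = 0\<^sub>v n \<Longrightarrow> v = 0\<^sub>v (rank A)"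
proof -
  let ?r = "rank A"
  obtain S where max: "maximal S (\<lambda>T. T \<subseteq> set (cols A) \<and> lin_indpt T)"
    using maximal_exists_superset[of "set (cols A)" "\<lambda>T. T \<subseteq> set (cols A) \<and> lin_indpt T" "{}"]
    by (metis (no_types, lifting) List.finite_set empty_subsetI finite.emptyI finite_lin_indpt2 insert_not_empty
        empty_iff)
  then have S: "S \<subseteq> set (cols A)" and indpt: "lin_indpt S" by (auto simp: maximal_def)
  have colsA: "set (cols A) \<subseteq> carrier_vec n" using A cols_dim by blast
  have finS: "finite S" using S finite_subset by blast
  have card: "card S = ?r" using rank_card_indpt[OF A max] by simp
  obtain xs where xs: "set xs = S" "distinct xs" using finite_distinct_list[OF finS] by blast
  have len: "length xs = ?r" using xs card distinct_card by metis
  define P where "P = mat_of_cols n xs"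
  have P: "P \<in> carrier_mat n ?r" unfolding P_def using len by auto
  have colsP: "cols P = xs" unfolding P_def using xs S colsA by (intro cols_mat_of_cols) auto
  have inj: "v = 0\<^sub>v ?r" if "v \<in> carrier_vec ?r" "P *\<^sub>v v = 0\<^sub>v n" for v
    using lin_depI[OF P that(1) _ that(2)] colsP xs indpt by auto
  have "\<exists>q \<in> carrier_vec ?r. c = P *\<^sub>v q" if c: "c \<in> set (cols A)" for c
  proof -
    have "c \<in> span S"
    proof (cases "c \<in> S")
      case True
      then show ?thesis using S colsA by (meson span_mem subset_trans)
    next
      \<comment> \<open>By maximality adding \<open>c\<close> destroys independence, so
        \<open>c\<close> lies in the span.\<close>
      case False
      then have "\<not> lin_indpt (insert c S)"
        using max c S unfolding maximal_def by (metis insert_subset subset_insertI insertI1)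
      then show ?thesis
        using lin_dep_iff_in_span[of S c] S colsA c indpt False by (auto simp: Un_commute)
    qed
    then obtain a where a: "c = lincomb a S"
      using finite_in_span[OF finS] S colsA by (metis subset_trans)
    have "P *\<^sub>v vec ?r (\<lambda>i. a (col P i)) = lincomb a (set (cols P))"
      using P colsP xs by (intro mat_mult_eq_lincomb) auto
    then show ?thesis using a colsP xs by (intro bexI[of _ "vec ?r (\<lambda>i. a (col P i))"]) auto
  qed
  then obtain q where q: "\<And>c. c \<in> set (cols A) \<Longrightarrow> q c \<in> carrier_vec ?r \<and> c = P *\<^sub>v q c"
    by metis
  define Q where "Q = mat_of_cols ?r (map q (cols A))"
  have Q: "Q \<in> carrier_mat ?r m" unfolding Q_def using A by auto
  have AQ: "A = P * Q"
  proof (rule mat_col_eqI)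
    fix i assume i: "i < dim_col (P * Q)"
    then have i': "i < dim_col A" using Q A by simp
    then have c: "col A i \<in> set (cols A)" by (metis cols_length cols_nth nth_mem)
    have "col Q i = q (col A i)"
      unfolding Q_def using q[OF c] i' by (subst col_mat_of_cols) auto
    then show "col A i = col (P * Q) i" using q[OF c] P Q i by (subst col_mult2) auto
  qed (use A P Q in auto)
  have "\<exists>j<m. col A j = xs ! i" if "i < ?r" for i
  proof -
    have "xs ! i \<in> set (cols A)" using that xs(1) S len nth_mem[of i xs] by auto
    then show ?thesis using A by (metis in_set_conv_nth cols_length cols_nth carrier_matD(2))
  qed
  then obtain f where f: "\<And>i. i < ?r \<Longrightarrow> f i < m \<and> col A (f i) = xs ! i" by metis
  define J where "J = mat m ?r (\<lambda>(k, i). if k = f i then 1 else (0 :: 'a))"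
  have J: "J \<in> carrier_mat m ?r" unfolding J_def by simp
  have PJ: "P = A * J"
  proof (rule mat_col_eqI)
    fix i assume "i < dim_col (A * J)"
    then have i: "i < ?r" using J by simp
    have "col J i = unit_vec m (f i)"
      unfolding J_def using i by (intro eq_vecI) (auto simp: unit_vec_def)
    then have "col (A * J) i = A *\<^sub>v unit_vec m (f i)"
      using A J i by (subst col_mult2[of _ n m _ ?r]) auto
    also have "\<dots> = vec n (\<lambda>k. row A k $ f i)"
      using A f[THEN conjunct1, OF i] by (intro eq_vecI) (auto simp: scalar_prod_right_unit)
    also have "\<dots> = col A (f i)"
      unfolding col_def using A f[THEN conjunct1, OF i] by (intro eq_vecI) auto
    finally have "col (A * J) i = col A (f i)" .
    then show "col P i = col (A * J) i"
      using f[OF i] P colsP i by (metis cols_nth carrier_matD(2))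
  qed (use A P J in auto)
  have "P * (Q * J) = P * Q * J" using P Q J by (simp add: mat_assoc)
  also have "\<dots> = P * 1\<^sub>m ?r" unfolding AQ[symmetric] PJ[symmetric] using P by simp
  finally have PQJ: "P * (Q * J) = P * 1\<^sub>m ?r" .
  have "Q * J = 1\<^sub>m ?r"
    by (rule eq_mat_if_mult_left_eq[OF P inj _ one_carrier_mat PQJ]) (use Q J in auto)
  from that[OF P Q J AQ PJ this inj] show thesis .
qed

text \<open>Equal ranks mean equal column spaces. Concretely, the rank factor of
  \<open>K * F\<close> is \<open>P' = P * ?Z\<close> with \<open>?Z\<close> square;
  \<open>P'\<close> is injective, hence so is \<open>?Z\<close>, and inverting \<open>?Z\<close>
  recovers \<open>K = P * Q\<close> from \<open>K * F\<close>.\<close>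

lemma (in vec_space) eq_mult_if_rank_mult_eq:
  assumes K: "K \<in> carrier_mat n m" and F: "F \<in> carrier_mat m l" and rank: "rank (K * F) = rank K"
  obtains Y where "Y \<in> carrier_mat l m" "K = K * F * Y"
proof -
  let ?r = "rank K"
  have KF: "K * F \<in> carrier_mat n l" using K F by simp
  obtain P Q where P: "P \<in> carrier_mat n ?r" and Q: "Q \<in> carrier_mat ?r m" and PQ: "K = P * Q"
    using rank_factorization[OF K] by metis
  obtain P' J' where P': "P' \<in> carrier_mat n ?r" and J': "J' \<in> carrier_mat l ?r"
    and PJ': "P' = K * F * J'"
    and inj: "\<And>v. v \<in> carrier_vec ?r \<Longrightarrow> P' *\<^sub>v v = 0\<^sub>v n \<Longrightarrow> v = 0\<^sub>v ?r"
    using rank_factorization[OF KF] unfolding rank by metis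
  let ?Z = "Q * (F * J')"
  have Z: "?Z \<in> carrier_mat ?r ?r" using Q F J' by simp
  have PZ: "P' = P * ?Z" unfolding PJ' PQ using P Q F J' by (simp add: mat_assoc)
  have P0: "P *\<^sub>v 0\<^sub>v ?r = 0\<^sub>v n" using P by (intro eq_vecI) auto
  have "det ?Z \<noteq> 0"
  proof
    assume "det ?Z = 0"
    then obtain v where v: "v \<in> carrier_vec ?r" "v \<noteq> 0\<^sub>v ?r" "?Z *\<^sub>v v = 0\<^sub>v ?r"
      using det_0_iff_vec_prod_zero_field[OF Z] by blast
    then have "P' *\<^sub>v v = 0\<^sub>v n"
      unfolding PZ using P Z P0 by (simp add: assoc_mult_mat_vec[OF P Z v(1)])
    then show False using inj v by blast
  qed
  then obtain Zi where Zi: "Zi \<in> carrier_mat ?r ?r" "?Z * Zi = 1\<^sub>m ?r"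
    using inverse_mat_exists[OF Z] by metis
  have "K * F * (J' * (Zi * Q)) = P * ?Z * (Zi * Q)"
    using K F J' Zi(1) P Q PJ' PZ by (metis (no_types, lifting) mat_assoc carrier_matD index_mult_mat(2,3))
  also have "\<dots> = P * ((?Z * Zi) * Q)"
    using P Q F J' Zi(1) by (simp add: mat_assoc)
  also have "\<dots> = K" using P Q by (simp add: Zi(2) PQ)
  finally show thesis using that[of "J' * (Zi * Q)"] J' Zi(1) Q by simp
qed

section \<open>Uniqueness, existence and factorizations of the Drazin inverse\<close>

lemma det_pow_mat:
  assumes T: "T \<in> carrier_mat n n"
  shows "det (T ^\<^sub>m j) = det T ^ j"
  using T by (induction j) (simp_all add: det_mult[OF pow_carrier_mat[OF T] T])

text \<open>Iterating \<open>X = X * (X * A)\<close> puts any power of \<open>A\<close> at the right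
  end of \<open>X\<close>, and dually at the left end of \<open>Y\<close>. With the power
  \<open>?k\<close> at both ends, the equations for \<open>A ^\<^sub>m (?k + 1)\<close> turn
  \<open>X\<close> into \<open>X * A * Y\<close> and then into \<open>Y\<close>.\<close>

lemma is_drazin_inverse_unique:
  assumes A: "A \<in> carrier_mat n n" and DX: "is_drazin_inverse A X" and DY: "is_drazin_inverse A Y"
  shows "X = Y"
proof -
  let ?k = "mat_index A"
  have X: "X \<in> carrier_mat n n" "X * A * X = X" "A * X = X * A" "A ^\<^sub>m (?k + 1) * X = A ^\<^sub>m ?k"
    using DX A by (auto simp: is_drazin_inverse_def)
  have Y: "Y \<in> carrier_mat n n" "Y * A * Y = Y" "A * Y = Y * A" "A ^\<^sub>m (?k + 1) * Y = A ^\<^sub>m ?k"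
    using DY A by (auto simp: is_drazin_inverse_def)
  have pow [simp]: "A ^\<^sub>m j \<in> carrier_mat n n" for j using A by (rule pow_carrier_mat)
  have powA: "A ^\<^sub>m j * A = A * A ^\<^sub>m j" for j
    by (rule pow_mat_mult_commute[OF A A A refl])
  have left: "\<exists>Z \<in> carrier_mat n n. X = Z * A ^\<^sub>m j" for j
  proof (induction j)
    case 0
    then show ?case using X(1) A by (intro bexI[of _ X]) auto
  next
    case (Suc j)
    then obtain Z where Z: "Z \<in> carrier_mat n n" "X = Z * A ^\<^sub>m j" by blast
    have "X = X * (X * A)" using X A by (metis mat_assoc carrier_matD)
    also have "\<dots> = X * (Z * A ^\<^sub>m j * A)" using Z(2) by simp
    also have "\<dots> = (X * Z) * A ^\<^sub>m Suc j"
      using X(1) Z(1) A pow[of j] by (simp add: mat_assoc)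
    finally show ?case using X(1) Z(1) by (intro bexI[of _ "X * Z"]) auto
  qed
  have right: "\<exists>Z \<in> carrier_mat n n. Y = A ^\<^sub>m j * Z" for j
  proof (induction j)
    case 0
    then show ?case using Y(1) A by (intro bexI[of _ Y]) auto
  next
    case (Suc j)
    then obtain Z where Z: "Z \<in> carrier_mat n n" "Y = A ^\<^sub>m j * Z" by blast
    have "Y = (A * Y) * Y" using Y by metis
    also have "\<dots> = (A * (A ^\<^sub>m j * Z)) * Y" using Z(2) by simp
    also have "\<dots> = (A * A ^\<^sub>m j) * (Z * Y)"
      using Y(1) Z(1) A pow[of j] by (simp add: mat_assoc)
    also have "\<dots> = A ^\<^sub>m Suc j * (Z * Y)" by (simp add: powA)
    finally show ?case using Y(1) Z(1) by (intro bexI[of _ "Z * Y"]) auto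
  qed
  obtain Z where Z: "Z \<in> carrier_mat n n" "X = Z * A ^\<^sub>m ?k" using left by blast
  obtain Z' where Z': "Z' \<in> carrier_mat n n" "Y = A ^\<^sub>m ?k * Z'" using right by blast
  have "X = Z * (A ^\<^sub>m (?k + 1) * Y)" using Z(2) Y(4) by simp
  also have "\<dots> = Z * A ^\<^sub>m ?k * (A * Y)"
    using Z(1) Y(1) A pow[of ?k] by (simp add: mat_assoc)
  also have "\<dots> = X * (A * (A ^\<^sub>m ?k * Z'))" using Z(2) Z'(2) by simp
  also have "\<dots> = X * A ^\<^sub>m (?k + 1) * Z'"
    using X(1) Z'(1) A pow[of ?k] powA[of ?k] by (simp add: mat_assoc)
  also have "X * A ^\<^sub>m (?k + 1) = A ^\<^sub>m (?k + 1) * X"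
    by (rule pow_mat_mult_commute[OF A X(1) A X(3), symmetric])
  also have "A ^\<^sub>m (?k + 1) * X * Z' = Y" using X(4) Z'(2) by simp
  finally show ?thesis .
qed

lemma drazin_inverse_eqI:
  assumes "A \<in> carrier_mat n n" and "is_drazin_inverse A X"
  shows "drazin_inverse A = X"
  unfolding drazin_inverse_def using assms is_drazin_inverse_unique by (intro the_equality) metis+

text \<open>With A^k = P Q of full rank, \<open>A\<close> acts on the column space of
  \<open>P\<close> as an invertible matrix \<open>T\<close> of order \<open>r\<close>, and Q P =
  T^k. Hence P T^(-k-1) Q is the Drazin inverse, while A^(k+1) = P (T Q). Both one-sided
  factorizations are provided because columns need the left factor \<open>P\<close> and rows the
  right factor \<open>C\<close>.\<close>

lemma drazin_inverse_factorization:
  assumes A: "A \<in> carrier_mat n n" and k: "mat_index A = k"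
    and rank: "mat_rank (A ^\<^sub>m (k + 1)) = r" "mat_rank (A ^\<^sub>m k) = r"
  obtains P C G H where "P \<in> carrier_mat n r" "C \<in> carrier_mat r n" "G \<in> carrier_mat r n"
    "H \<in> carrier_mat n r" "A ^\<^sub>m (k + 1) = P * C" "det (C * P) \<noteq> 0"
    "drazin_inverse A = P * G" "drazin_inverse A = H * C"
    "A ^\<^sub>m (k + 1) * drazin_inverse A = A ^\<^sub>m k" "drazin_inverse A * A ^\<^sub>m (k + 1) = A ^\<^sub>m k"
proof -
  interpret vec_space "TYPE(complex)" n .
  have pow [simp]: "A ^\<^sub>m j \<in> carrier_mat n n" for j using A by (rule pow_carrier_mat)
  have powA: "A ^\<^sub>m j * A = A * A ^\<^sub>m j" for j
    by (rule pow_mat_mult_commute[OF A A A refl])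
  let ?K = "A ^\<^sub>m k"
  have rk: "rank (A ^\<^sub>m (k + 1)) = r" "rank ?K = r"
    using rank A by (simp_all add: mat_rank_def pow_mat_dim)
  obtain P Q J where P: "P \<in> carrier_mat n r" and Q: "Q \<in> carrier_mat r n"
    and J: "J \<in> carrier_mat n r" and PQ: "?K = P * Q" and KJ: "P = ?K * J" and QJ: "Q * J = 1\<^sub>m r"
    and inj: "\<And>v. v \<in> carrier_vec r \<Longrightarrow> P *\<^sub>v v = 0\<^sub>v n \<Longrightarrow> v = 0\<^sub>v r"
    using rank_factorization[OF pow[of k]] unfolding rk by metis
  have "rank (?K * A) = rank ?K" using rk by simp
  from eq_mult_if_rank_mult_eq[OF pow A this] obtain Y where
    Y: "Y \<in> carrier_mat n n" "?K = ?K * A * Y" by metis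
  \<comment> \<open>The matrix of \<open>A\<close> on the column space of A^k in the basis formed by
    the columns of \<open>P\<close>; \<open>J\<close> is a right inverse of
    \<open>Q\<close>.\<close>
  define T where "T = Q * (A * J)"
  have T: "T \<in> carrier_mat r r" unfolding T_def using Q A J by simp
  note dims = carrier_matD[OF P] carrier_matD[OF Q] carrier_matD[OF J] carrier_matD[OF Y(1)]
    carrier_matD[OF T] carrier_matD[OF A] carrier_matD[OF pow]
  have AP: "A * P = P * T"
  proof -
    have "A * P = ?K * A * J" unfolding KJ powA by (simp add: mat_assoc dims)
    also have "\<dots> = P * T" unfolding PQ T_def by (simp add: mat_assoc dims)
    finally show ?thesis .
  qed
  have QA: "Q * A = T * Q"
  proof (rule eq_mat_if_mult_left_eq[OF P inj])
    have "P * (Q * A) = ?K * A" unfolding PQ by (simp add: mat_assoc dims)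
    also have "\<dots> = A * P * Q" unfolding powA unfolding PQ by (simp add: mat_assoc dims)
    also have "\<dots> = P * (T * Q)" unfolding AP by (simp add: mat_assoc dims)
    finally show "P * (Q * A) = P * (T * Q)" .
  qed (use Q A T in auto)
  \<comment> \<open>Here the equality of ranks enters: the matrix \<open>Y\<close> that undoes the
    extra factor \<open>A\<close> yields a right inverse of \<open>T\<close>.\<close>
  have "T * (Q * (Y * J)) = 1\<^sub>m r"
  proof -
    have "P * Q = P * (T * (Q * Y))"
    proof -
      have "P * Q = ?K * A * Y" using PQ Y(2) by simp
      also have "\<dots> = A * P * Q * Y" unfolding powA unfolding PQ by (simp add: mat_assoc dims)
      also have "\<dots> = P * (T * (Q * Y))" unfolding AP by (simp add: mat_assoc dims)
      finally show ?thesis .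
    qed
    have "T * (Q * Y) = Q"
      by (rule eq_mat_if_mult_left_eq[OF P inj _ Q \<open>P * Q = P * (T * (Q * Y))\<close>[symmetric]])
        (use Q T Y(1) in auto)
    then have "T * (Q * Y) * J = 1\<^sub>m r" using QJ by simp
    then show ?thesis by (simp add: mat_assoc dims)
  qed
  then have "det T * det (Q * (Y * J)) = 1"
    using det_mult[OF T, of "Q * (Y * J)"] Q Y(1) J by simp
  then have detT: "det T \<noteq> 0" by auto
  define E where "E = Q * P"
  have E: "E \<in> carrier_mat r r" unfolding E_def using Q P by simp
  have E_pow: "E = T ^\<^sub>m k"
  proof (rule eq_mat_if_mult_left_eq[OF P inj])
    have "P * E = ?K * P" unfolding PQ E_def by (simp add: mat_assoc dims)
    also have "\<dots> = P * T ^\<^sub>m k" by (rule pow_mat_mult_commute[OF A P T AP])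
    finally show "P * E = P * T ^\<^sub>m k" .
  qed (use E T in \<open>auto intro: pow_carrier_mat\<close>)
  have TE: "T * E = E * T"
    unfolding E_pow by (rule pow_mat_mult_commute[OF T T T refl, symmetric])
  have detE: "det E \<noteq> 0" unfolding E_pow using detT by (simp add: det_pow_mat[OF T])
  obtain S where S: "S \<in> carrier_mat r r" "T * S = 1\<^sub>m r" "S * T = 1\<^sub>m r"
    using inverse_mat_exists[OF T detT] by metis
  obtain F where F: "F \<in> carrier_mat r r" "E * F = 1\<^sub>m r" "F * E = 1\<^sub>m r"
    using inverse_mat_exists[OF E detE] by metis
  note dims = dims carrier_matD[OF E] carrier_matD[OF S(1)] carrier_matD[OF F(1)]
  have TF: "T * F = F * T"
  proof -
    have "F * T = F * (T * (E * F))" using F T by simp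
    also have "\<dots> = F * (T * E) * F" by (simp add: mat_assoc dims)
    also have "\<dots> = (F * E) * (T * F)" unfolding TE by (simp add: mat_assoc dims)
    also have "\<dots> = T * F" using F T by simp
    finally show ?thesis by simp
  qed
  \<comment> \<open>\<open>F\<close> inverts E = T^k and \<open>S\<close> inverts \<open>T\<close>,
    so \<open>V\<close> is T^(-k-1).\<close>
  define V where "V = F * S"
  have V: "V \<in> carrier_mat r r" unfolding V_def using F S by simp
  note dims = dims carrier_matD[OF V]
  have VT: "V * T = F" unfolding V_def using S(3) F(1) by (simp add: mat_assoc dims)
  have TV: "T * V = F"
  proof -
    have "T * V = T * F * S" unfolding V_def by (simp add: mat_assoc dims)
    also have "\<dots> = F" unfolding TF using S(2) F(1) by (simp add: mat_assoc dims)
    finally show ?thesis .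
  qed
  define X where "X = P * (V * Q)"
  have X: "X \<in> carrier_mat n n" unfolding X_def using P V Q by simp
  have AX: "A * X = P * (F * Q)"
  proof -
    have "A * X = A * P * (V * Q)" unfolding X_def by (simp add: mat_assoc dims)
    also have "\<dots> = P * ((T * V) * Q)" unfolding AP by (simp add: mat_assoc dims)
    finally show ?thesis unfolding TV .
  qed
  have XA: "X * A = P * (F * Q)"
  proof -
    have "X * A = P * (V * (Q * A))" unfolding X_def by (simp add: mat_assoc dims)
    also have "\<dots> = P * ((V * T) * Q)" unfolding QA by (simp add: mat_assoc dims)
    finally show ?thesis unfolding VT .
  qed
  have XAX: "X * A * X = X"
  proof -
    have "X * A * X = P * ((F * (Q * P)) * (V * Q))"
      unfolding XA unfolding X_def by (simp add: mat_assoc dims)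
    also have "\<dots> = X" unfolding E_def[symmetric] F(3) X_def using V Q by simp
    finally show ?thesis .
  qed
  have KAX: "A ^\<^sub>m (k + 1) * X = ?K"
  proof -
    have "A ^\<^sub>m (k + 1) * X = ?K * (A * X)" using X by (simp add: mat_assoc dims)
    also have "\<dots> = P * (((Q * P) * F) * Q)" unfolding AX PQ by (simp add: mat_assoc dims)
    also have "\<dots> = ?K" unfolding E_def[symmetric] F(2) PQ using Q by simp
    finally show ?thesis .
  qed
  have D: "drazin_inverse A = X"
    using X A KAX XAX AX XA k by (intro drazin_inverse_eqI[OF A]) (simp add: is_drazin_inverse_def)
  show thesis
  \<comment> \<open>The last witness carries an extra \<open>S\<close> to cancel the
    \<open>T\<close> in \<open>C = T * Q\<close>.\<close>
  proof (rule that[of P "T * Q" "V * Q" "P * (V * S)"])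
    show "A ^\<^sub>m (k + 1) = P * (T * Q)"
      by (simp add: PQ QA mat_assoc dims)
    show "det (T * Q * P) \<noteq> 0"
      using detT detE by (simp add: mat_assoc dims E_def[symmetric] det_mult[OF T E])
    have "P * (V * S) * (T * Q) = P * (V * ((S * T) * Q))" by (simp add: mat_assoc dims)
    then show "drazin_inverse A = P * (V * S) * (T * Q)" unfolding D X_def S(3) using Q by simp
    show "A ^\<^sub>m (k + 1) * drazin_inverse A = ?K" unfolding D by (rule KAX)
    then show "drazin_inverse A * A ^\<^sub>m (k + 1) = ?K"
      unfolding D using pow_mat_mult_commute[OF A X A, of "k + 1"] AX XA by simp
    show "drazin_inverse A = P * (V * Q)" unfolding D X_def ..
  qed (use P Q T V S in auto)
qed

section \<open>Determinantal formulas for the Drazin inverse applied to a vector\<close>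

lemma drazin_inverse_carrier:
  assumes "A \<in> carrier_mat n n" "mat_index A = k"
    and "mat_rank (A ^\<^sub>m (k + 1)) = r" "mat_rank (A ^\<^sub>m k) = r"
  shows "drazin_inverse A \<in> carrier_mat n n"
  using drazin_inverse_factorization[OF assms] by (metis mult_carrier_mat)

lemma minor_sum_index_power_nonzero:
  assumes "A \<in> carrier_mat n n" "mat_index A = k"
    and "mat_rank (A ^\<^sub>m (k + 1)) = r" "mat_rank (A ^\<^sub>m k) = r" and r: "r \<le> n"
  shows "minor_sum r n (A ^\<^sub>m (k + 1)) \<noteq> 0"
proof -
  obtain P C where "P \<in> carrier_mat n r" "C \<in> carrier_mat r n" "A ^\<^sub>m (k + 1) = P * C" "det (C * P) \<noteq> 0"
    using drazin_inverse_factorization[OF assms(1-4)] by metis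
  then show ?thesis using minor_sum_mult_eq_det r by metis
qed

text \<open>Since A^k is A^(k+1) times the Drazin inverse, the replacing column is
  \<open>?M *\<^sub>v (?X *\<^sub>v y)\<close>, and \<open>?X *\<^sub>v y\<close> has the form
  \<open>P *\<^sub>v w\<close> with \<open>w = G *\<^sub>v y\<close>.\<close>

lemma minor_sum_with_replace_col_drazin:
  assumes A: "A \<in> carrier_mat n n" "mat_index A = k"
    "mat_rank (A ^\<^sub>m (k + 1)) = r" "mat_rank (A ^\<^sub>m k) = r" and r: "r \<le> n"
    and y: "y \<in> carrier_vec n" and i: "i < n"
  shows "minor_sum_with r n i (replace_col (A ^\<^sub>m (k + 1)) (A ^\<^sub>m k *\<^sub>v y) i) =
    (drazin_inverse A *\<^sub>v y) $ i * minor_sum r n (A ^\<^sub>m (k + 1))"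
proof -
  let ?X = "drazin_inverse A" and ?M = "A ^\<^sub>m (k + 1)"
  obtain P C G where PCG: "P \<in> carrier_mat n r" "C \<in> carrier_mat r n" "G \<in> carrier_mat r n"
    and M: "?M = P * C" and XG: "?X = P * G" and MX: "?M * ?X = A ^\<^sub>m k"
    using drazin_inverse_factorization[OF A] by metis
  have Xy: "?X *\<^sub>v y = P *\<^sub>v (G *\<^sub>v y)"
    unfolding XG by (rule assoc_mult_mat_vec[OF PCG(1,3) y])
  have "A ^\<^sub>m k *\<^sub>v y = ?M *\<^sub>v (?X *\<^sub>v y)"
    unfolding MX[symmetric] using drazin_inverse_carrier[OF A] A(1) y
    by (intro assoc_mult_mat_vec[of _ n n _ n]) (auto intro: pow_carrier_mat)
  then have b: "A ^\<^sub>m k *\<^sub>v y = P * C *\<^sub>v (P *\<^sub>v (G *\<^sub>v y))" by (simp only: M Xy)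
  show ?thesis
    unfolding b unfolding M Xy using PCG y r i by (intro minor_sum_with_replace_col_mult) auto
qed

lemma minor_sum_transpose:
  assumes "N \<in> carrier_mat n n"
  shows "minor_sum s n N\<^sup>T = minor_sum s n N" "minor_sum_with s n i N\<^sup>T = minor_sum_with s n i N"
  using assms by (auto simp: index_sets_with_def index_sets_def intro!: sum.cong principal_minor_transpose)

lemma replace_row_transpose:
  assumes "M \<in> carrier_mat n n"
  shows "replace_row M b j = (replace_col M\<^sup>T b j)\<^sup>T"
  using assms by (intro eq_matI) (auto simp: replace_row_def replace_col_def)

text \<open>The transposed power is \<open>C\<^sup>T * P\<^sup>T\<close>, so
  \<open>C\<^sup>T\<close> takes over the role of \<open>P\<close>; the factorization
  \<open>H * C\<close> of the Drazin inverse puts the transposed solution in its range. Row vectors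
  are stored as plain vectors, which is why multiplication from the right appears as a transposed
  matrix acting on \<open>y\<close>.\<close>

lemma minor_sum_with_replace_row_drazin:
  assumes B: "B \<in> carrier_mat n n" "mat_index B = k"
    "mat_rank (B ^\<^sub>m (k + 1)) = r" "mat_rank (B ^\<^sub>m k) = r" and r: "r \<le> n"
    and y: "y \<in> carrier_vec n" and i: "i < n"
  shows "minor_sum_with r n i (replace_row (B ^\<^sub>m (k + 1)) ((B ^\<^sub>m k)\<^sup>T *\<^sub>v y) i) =
    ((drazin_inverse B)\<^sup>T *\<^sub>v y) $ i * minor_sum r n (B ^\<^sub>m (k + 1))"
proof -
  let ?X = "drazin_inverse B" and ?M = "B ^\<^sub>m (k + 1)"
  obtain P C H where PCH: "P \<in> carrier_mat n r" "C \<in> carrier_mat r n" "H \<in> carrier_mat n r"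
    and M: "?M = P * C" and XH: "?X = H * C" and XM: "?X * ?M = B ^\<^sub>m k"
    using drazin_inverse_factorization[OF B] by metis
  have X: "?X \<in> carrier_mat n n" by (rule drazin_inverse_carrier[OF B])
  have Mc: "?M \<in> carrier_mat n n" using B(1) by (rule pow_carrier_mat)
  have MT: "?M\<^sup>T = C\<^sup>T * P\<^sup>T" unfolding M by (rule transpose_mult[OF PCH(1,2)])
  have Xy: "?X\<^sup>T *\<^sub>v y = C\<^sup>T *\<^sub>v (H\<^sup>T *\<^sub>v y)"
    unfolding XH transpose_mult[OF PCH(3,2)] using PCH y by (intro assoc_mult_mat_vec) auto
  have "(B ^\<^sub>m k)\<^sup>T *\<^sub>v y = ?M\<^sup>T *\<^sub>v (?X\<^sup>T *\<^sub>v y)"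
    unfolding XM[symmetric] transpose_mult[OF X Mc] using X Mc y
    by (intro assoc_mult_mat_vec[of _ n n _ n]) auto
  then have b: "(B ^\<^sub>m k)\<^sup>T *\<^sub>v y = C\<^sup>T * P\<^sup>T *\<^sub>v (C\<^sup>T *\<^sub>v (H\<^sup>T *\<^sub>v y))" by (simp only: MT Xy)
  have "minor_sum_with r n i (replace_row ?M ((B ^\<^sub>m k)\<^sup>T *\<^sub>v y) i) =
      minor_sum_with r n i (replace_col ?M\<^sup>T ((B ^\<^sub>m k)\<^sup>T *\<^sub>v y) i)"
    unfolding replace_row_transpose[OF Mc] using Mc by (intro minor_sum_transpose) auto
  also have "\<dots> = (?X\<^sup>T *\<^sub>v y) $ i * minor_sum r n ?M\<^sup>T"
    unfolding b unfolding MT Xy using PCH y r i by (intro minor_sum_with_replace_col_mult) auto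
  also have "minor_sum r n ?M\<^sup>T = minor_sum r n ?M" by (rule minor_sum_transpose(1)[OF Mc])
  finally show ?thesis .
qed

section \<open>The two-sided formulas\<close>

lemma row_mult_eq_transpose_mult_vec:
  fixes Y Z :: "'a :: comm_semiring_0 mat"
  assumes "Y \<in> carrier_mat n m" "Z \<in> carrier_mat m l" "i < n"
  shows "row (Y * Z) i = Z\<^sup>T *\<^sub>v row Y i"
  using assms by (intro eq_vecI) (auto intro!: comm_scalar_prod[of _ m])

text \<open>The conclusion includes that the denominator is nonzero, because division by zero has
  the value 0 and the quotients would otherwise not be genuine.\<close>

theorem theorem3p6:
  fixes A B D Dt X :: "complex mat"
    and n m k1 k2 r1 r2 :: nat
    and dA dB :: "nat \<Rightarrow> complex vec"
  assumes A: "A \<in> carrier_mat n n"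
    and B: "B \<in> carrier_mat m m"
    and D: "D \<in> carrier_mat n m"
    and indA: "mat_index A = k1"
    and rankA: "mat_rank (A ^\<^sub>m (k1 + 1)) = r1" "mat_rank (A ^\<^sub>m k1) = r1"
    and r1: "1 \<le> r1" "r1 \<le> n"
    and indB: "mat_index B = k2"
    and rankB: "mat_rank (B ^\<^sub>m (k2 + 1)) = r2" "mat_rank (B ^\<^sub>m k2) = r2"
    and r2: "1 \<le> r2" "r2 \<le> m"
    and Dt: "Dt = A ^\<^sub>m k1 * D * B ^\<^sub>m k2"
    and dB: "\<And>j. j < m \<Longrightarrow> dB j =
          vec n (\<lambda>l. \<Sum>\<alpha>\<in>index_sets_with r2 m j.
                       principal_minor (replace_row (B ^\<^sub>m (k2 + 1)) (row Dt l) j) \<alpha>)"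
    and dA: "\<And>i. i < n \<Longrightarrow> dA i =
          vec m (\<lambda>l. \<Sum>\<beta>\<in>index_sets_with r1 n i.
                       principal_minor (replace_col (A ^\<^sub>m (k1 + 1)) (col Dt l) i) \<beta>)"
    and X: "X = drazin_inverse_solution A B D"
  shows "X \<in> carrier_mat n m \<and>
    (\<Sum>\<beta>\<in>index_sets r1 n. principal_minor (A ^\<^sub>m (k1 + 1)) \<beta>) *
      (\<Sum>\<alpha>\<in>index_sets r2 m. principal_minor (B ^\<^sub>m (k2 + 1)) \<alpha>) \<noteq> 0 \<and>
    (\<forall>i<n. \<forall>j<m.
       X $$ (i, j) =
         (\<Sum>\<beta>\<in>index_sets_with r1 n i.
            principal_minor (replace_col (A ^\<^sub>m (k1 + 1)) (dB j) i) \<beta>) /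
         ((\<Sum>\<beta>\<in>index_sets r1 n. principal_minor (A ^\<^sub>m (k1 + 1)) \<beta>) *
          (\<Sum>\<alpha>\<in>index_sets r2 m. principal_minor (B ^\<^sub>m (k2 + 1)) \<alpha>)) \<and>
       X $$ (i, j) =
         (\<Sum>\<alpha>\<in>index_sets_with r2 m j.
            principal_minor (replace_row (B ^\<^sub>m (k2 + 1)) (dA i) j) \<alpha>) /
         ((\<Sum>\<beta>\<in>index_sets r1 n. principal_minor (A ^\<^sub>m (k1 + 1)) \<beta>) *
          (\<Sum>\<alpha>\<in>index_sets r2 m. principal_minor (B ^\<^sub>m (k2 + 1)) \<alpha>)))"
proof -
  note hA = A indA rankA and hB = B indB rankB
  let ?eA = "minor_sum r1 n (A ^\<^sub>m (k1 + 1))" and ?eB = "minor_sum r2 m (B ^\<^sub>m (k2 + 1))"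
  define AD where "AD = drazin_inverse A"
  define BD where "BD = drazin_inverse B"
  have AD: "AD \<in> carrier_mat n n" unfolding AD_def by (rule drazin_inverse_carrier[OF hA])
  have BD: "BD \<in> carrier_mat m m" unfolding BD_def by (rule drazin_inverse_carrier[OF hB])
  have Ak: "A ^\<^sub>m k1 \<in> carrier_mat n n" using A by (rule pow_carrier_mat)
  have Bk: "B ^\<^sub>m k2 \<in> carrier_mat m m" using B by (rule pow_carrier_mat)
  note carriers = AD BD Ak Bk D
  note dims = carrier_matD[OF A] carrier_matD[OF B] carrier_matD[OF D] carrier_matD[OF AD] carrier_matD[OF BD]
  have X_eq: "X = AD * D * BD" unfolding X drazin_inverse_solution_def AD_def BD_def ..
  have Xc: "X \<in> carrier_mat n m" unfolding X_eq using carriers by simp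
  have eA: "?eA \<noteq> 0" by (rule minor_sum_index_power_nonzero[OF hA r1(2)])
  have eB: "?eB \<noteq> 0" by (rule minor_sum_index_power_nonzero[OF hB r2(2)])
  have "minor_sum_with r1 n i (replace_col (A ^\<^sub>m (k1 + 1)) (dB j) i) = X $$ (i, j) * (?eA * ?eB)"
    if i: "i < n" and j: "j < m" for i j
  proof -
    have y: "col (D * BD) j \<in> carrier_vec n" by (rule carrier_vecI) (simp add: dims)
    \<comment> \<open>The row formula for \<open>B\<close>, applied to row \<open>l\<close> of
      \<open>A ^\<^sub>m k1 * D\<close>, evaluates entry \<open>l\<close> of \<open>dB j\<close>.
      Pulling \<open>A ^\<^sub>m k1\<close> out in front gives exactly the kind of column that the
      formula for \<open>A\<close> accepts.\<close>
    have "dB j = A ^\<^sub>m k1 *\<^sub>v (?eB \<cdot>\<^sub>v col (D * BD) j)"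
    proof (rule eq_vecI)
      fix l assume "l < dim_vec (A ^\<^sub>m k1 *\<^sub>v (?eB \<cdot>\<^sub>v col (D * BD) j))"
      then have l: "l < n" by (simp add: dims)
      have y': "row (A ^\<^sub>m k1 * D) l \<in> carrier_vec m" by (rule carrier_vecI) (simp add: dims)
      have "row Dt l = (B ^\<^sub>m k2)\<^sup>T *\<^sub>v row (A ^\<^sub>m k1 * D) l"
        unfolding Dt using carriers l by (intro row_mult_eq_transpose_mult_vec) auto
      then have "dB j $ l = (BD\<^sup>T *\<^sub>v row (A ^\<^sub>m k1 * D) l) $ j * ?eB"
        using minor_sum_with_replace_row_drazin[OF hB r2(2) y' j] l j by (simp add: dB BD_def)
      also have "BD\<^sup>T *\<^sub>v row (A ^\<^sub>m k1 * D) l = row (A ^\<^sub>m k1 * D * BD) l"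
        using carriers l by (intro row_mult_eq_transpose_mult_vec[symmetric]) auto
      also have "A ^\<^sub>m k1 * D * BD = A ^\<^sub>m k1 * (D * BD)"
        by (simp add: mat_assoc dims)
      finally show "dB j $ l = (A ^\<^sub>m k1 *\<^sub>v (?eB \<cdot>\<^sub>v col (D * BD) j)) $ l"
        using l j by (simp add: dims)
    qed (use j dB in \<open>simp add: dims\<close>)
    then have "minor_sum_with r1 n i (replace_col (A ^\<^sub>m (k1 + 1)) (dB j) i) =
        (AD *\<^sub>v (?eB \<cdot>\<^sub>v col (D * BD) j)) $ i * ?eA"
      using minor_sum_with_replace_col_drazin[OF hA r1(2) _ i, of "?eB \<cdot>\<^sub>v col (D * BD) j"] y
      by (simp add: AD_def)
    also have "(AD *\<^sub>v (?eB \<cdot>\<^sub>v col (D * BD) j)) $ i = ?eB * (AD * (D * BD)) $$ (i, j)"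
      using i j by (simp add: dims)
    also have "AD * (D * BD) = X" unfolding X_eq by (simp add: mat_assoc dims)
    finally show ?thesis by (simp add: mult_ac)
  qed
  moreover have "minor_sum_with r2 m j (replace_row (B ^\<^sub>m (k2 + 1)) (dA i) j) = X $$ (i, j) * (?eA * ?eB)"
    if i: "i < n" and j: "j < m" for i j
  proof -
    have y: "row (AD * D) i \<in> carrier_vec m" by (rule carrier_vecI) (simp add: dims)
    \<comment> \<open>The mirror image: the column formula for \<open>A\<close> is applied first, to
      the columns of \<open>D * B ^\<^sub>m k2\<close>, and the row formula for \<open>B\<close>
      afterwards.\<close>
    have "dA i = (B ^\<^sub>m k2)\<^sup>T *\<^sub>v (?eA \<cdot>\<^sub>v row (AD * D) i)"
    proof (rule eq_vecI)
      fix l assume "l < dim_vec ((B ^\<^sub>m k2)\<^sup>T *\<^sub>v (?eA \<cdot>\<^sub>v row (AD * D) i))"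
      then have l: "l < m" by (simp add: dims split: if_splits)
      have y': "col (D * B ^\<^sub>m k2) l \<in> carrier_vec n" by (rule carrier_vecI) (simp add: dims)
      have "Dt = A ^\<^sub>m k1 * (D * B ^\<^sub>m k2)"
        unfolding Dt by (simp add: mat_assoc dims)
      then have "col Dt l = A ^\<^sub>m k1 *\<^sub>v col (D * B ^\<^sub>m k2) l"
        using col_mult2[OF Ak mult_carrier_mat[OF D Bk] l] by simp
      then have "dA i $ l = (AD *\<^sub>v col (D * B ^\<^sub>m k2) l) $ i * ?eA"
        using minor_sum_with_replace_col_drazin[OF hA r1(2) y' i] l i by (simp add: dA AD_def)
      also have "(AD *\<^sub>v col (D * B ^\<^sub>m k2) l) $ i = (AD * (D * B ^\<^sub>m k2)) $$ (i, l)"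
        using i l by (simp add: dims)
      also have "AD * (D * B ^\<^sub>m k2) = AD * D * B ^\<^sub>m k2"
        by (simp add: mat_assoc dims)
      also have "\<dots> $$ (i, l) = row (AD * D * B ^\<^sub>m k2) i $ l"
        using i l by (simp add: dims)
      also have "row (AD * D * B ^\<^sub>m k2) i = (B ^\<^sub>m k2)\<^sup>T *\<^sub>v row (AD * D) i"
        using carriers i by (intro row_mult_eq_transpose_mult_vec) auto
      finally show "dA i $ l = ((B ^\<^sub>m k2)\<^sup>T *\<^sub>v (?eA \<cdot>\<^sub>v row (AD * D) i)) $ l"
        using i l y by (simp add: dims)
    qed (use i dA in \<open>simp add: dims split: if_splits\<close>)
    then have "minor_sum_with r2 m j (replace_row (B ^\<^sub>m (k2 + 1)) (dA i) j) =
        (BD\<^sup>T *\<^sub>v (?eA \<cdot>\<^sub>v row (AD * D) i)) $ j * ?eB"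
      using minor_sum_with_replace_row_drazin[OF hB r2(2) _ j, of "?eA \<cdot>\<^sub>v row (AD * D) i"] y
      by (simp add: BD_def)
    also have "BD\<^sup>T *\<^sub>v (?eA \<cdot>\<^sub>v row (AD * D) i) = ?eA \<cdot>\<^sub>v row X i"
      unfolding X_eq row_mult_eq_transpose_mult_vec[OF mult_carrier_mat[OF AD D] BD i]
      using BD y by (intro mult_mat_vec[of _ m m]) auto
    finally show ?thesis using Xc i j by (simp add: mult_ac)
  qed
  ultimately show ?thesis using Xc eA eB by simp
qed

end
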